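(* For every real $t\geq 1$ and every discrete log-concave random variable $X$, $$\mathbb{P}(X \geq \mathbb{E}[X] + t) \leq 1-\frac{1}{e},$$ and for each fixed $t\geq 1$ this inequality is sharp: the constant $1-\frac1e$ cannot be replaced by any smaller constant, i.e. $$\sup_X \mathbb{P}(X \geq \mathbb{E}[X] + t) = 1-\frac{1}{e},$$ where the supremum is over all discrete log-concave random variables $X$.
   Context: An integer-valued random variable $X$ with probability mass function $p(k)=\mathbb{P}(X=k)$, $k\in\mathbb{Z}$, is called (discrete) log-concave if $p(k)^2 \geq p(k-1)\,p(k+1)$ for all $k\in\mathbb{Z}$ and $X$ has contiguous support, meaning that $\{k\in\mathbb{Z} : p(k)>0\}$ is a set of consecutive integers (finite or infinite in either direction). *)

theory Defs
  imports "HOL-Probability.Probability"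
begin

definition mass :: "'a measure \<Rightarrow> ('a \<Rightarrow> int) \<Rightarrow> int \<Rightarrow> real" where
  "mass M X k = \<P>(\<omega> in M. X \<omega> = k)"

text \<open>The second condition is equivalent to saying that the support is a (finite or infinite)
  set of consecutive integers, i.e. that it has no gaps.\<close>

definition log_concave_mass :: "(int \<Rightarrow> real) \<Rightarrow> bool" where
  "log_concave_mass p \<longleftrightarrow>
     (\<forall>k. (p k)\<^sup>2 \<ge> p (k - 1) * p (k + 1)) \<and>
     (\<forall>i j k. i \<le> j \<longrightarrow> j \<le> k \<longrightarrow> p i > 0 \<longrightarrow> p k > 0 \<longrightarrow> p j > 0)"

definition discrete_log_concave :: "'a measure \<Rightarrow> ('a \<Rightarrow> int) \<Rightarrow> bool" where
  "discrete_log_concave M X \<longleftrightarrow>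
     prob_space M \<and> X \<in> measurable M (count_space UNIV) \<and> log_concave_mass (mass M X)"

text \<open>A log-concave mass function has exponentially decaying tails, so for every
  \<open>discrete_log_concave M X\<close> the variable is integrable and the Bochner integral below is its
  genuine expectation; no integrability hypothesis is needed.\<close>

definition upper_deviation_prob :: "real \<Rightarrow> 'a measure \<Rightarrow> ('a \<Rightarrow> int) \<Rightarrow> real" where
  "upper_deviation_prob t M X =
     \<P>(\<omega> in M. real_of_int (X \<omega>) \<ge> (\<integral>\<omega>'. real_of_int (X \<omega>') \<partial>M) + t)"

text \<open>Every integer-valued law is realised on a probability space with underlying type
  \<^typ>\<open>int\<close> (by the identity), so the collection of all discrete log-concave random variables,
  which ranges over arbitrary probability spaces, may be replaced in a supremum of
  law-dependent quantities by the following set.\<close>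

definition log_concave_variables :: "(int measure \<times> (int \<Rightarrow> int)) set" where
  "log_concave_variables = {(M, X). discrete_log_concave M X}"

end

theory Submission
  imports Defs "HOL-Real_Asymp.Real_Asymp"
begin

text \<open>
  The bound is a discrete form of Gruenbaum's inequality. With \<open>m = \<lceil>E X + t\<rceil>\<close> and \<open>t \<ge> 1\<close>, the
  variable \<open>W = m - 1 - X\<close> is log-concave with \<open>E W \<ge> 0\<close>, and \<open>X \<ge> E X + t\<close> means \<open>W < 0\<close>; so it
  has to be shown that a log-concave \<open>W\<close> with nonnegative mean satisfies \<open>P(W \<ge> 0) \<ge> 1/e\<close>.

  The tail \<open>F k = P(W \<ge> k)\<close> is again log-concave (\<open>log_concave_tail\<close>). Hence it lies below the
  geometric sequence that agrees with it at \<open>0\<close> and \<open>1\<close>: \<open>F k \<le> F 0 * r^k\<close> for all integers \<open>k\<close>,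
  where \<open>r = F 1 / F 0\<close>. For every \<open>N \<ge> 1\<close>, summing tails gives
  \<open>N \<le> E (W + N) \<le> E (W + N)\<^sup>+ = (\<Sum>k > -N. F k) \<le> F 0 / (r^(N-1) * (1 - r))\<close>,
  that is, \<open>F 0 \<ge> N * r^(N-1) * (1 - r)\<close>. A suitable choice of \<open>N\<close> makes the right-hand side
  at least \<open>1/e\<close> (\<open>exists_geometric_weight_ge\<close>).

  Equality is approached by \<open>X = -G\<close> with \<open>G\<close> geometric of mean \<open>n + t\<close>: then
  \<open>P(X \<ge> E X + t) = P(G \<le> n) = 1 - q^(n+1)\<close> with \<open>q = (n+t)/(n+t+1)\<close>, and \<open>q^(n+1)\<close> tends to \<open>1/e\<close>.
\<close>

section \<open>Log-concave sequences\<close>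

text \<open>Log-concavity says that ratios of consecutive terms decrease; this is the corresponding
  comparison of two ratios at distant places, with denominators cleared so that zeros are allowed.\<close>

lemma log_concave_mass_spread:
  assumes lc: "log_concave_mass p" and nn: "\<And>k. 0 \<le> p k"
  shows "p (k - 1) * p (k + int n + 1) \<le> p k * p (k + int n)"
proof (induction n)
  case 0
  then show ?case using lc by (simp add: log_concave_mass_def power2_eq_square)
next
  case (Suc n)
  let ?a = "p (k - 1)" and ?b = "p k" and ?c = "p (k + int n)" and ?d = "p (k + int n + 1)"
    and ?e = "p (k + int n + 2)"
  have gap: "p i > 0 \<Longrightarrow> p l > 0 \<Longrightarrow> i \<le> j \<Longrightarrow> j \<le> l \<Longrightarrow> p j > 0" for i j l
    using lc unfolding log_concave_mass_def by blast
  have cde: "?c * ?e \<le> ?d * ?d"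
    using lc unfolding log_concave_mass_def
    by (metis add_diff_cancel_right' group_cancel.add1 one_add_one power2_eq_square)
  have "?a * ?e \<le> ?b * ?d"
  proof (cases "?a = 0 \<or> ?e = 0")
    case True
    then show ?thesis using nn by auto
  next
    case False
    then have "?a > 0" "?e > 0" using nn by (auto simp: less_le)
    then have d: "?d > 0" by (rule gap) auto
    have "(?a * ?e) * ?d \<le> (?b * ?c) * ?e"
      using mult_right_mono[OF Suc.IH nn[of "k + int n + 2"]] by (simp add: algebra_simps)
    also have "\<dots> \<le> (?b * ?d) * ?d"
      using mult_left_mono[OF cde nn[of k]] by (simp add: algebra_simps)
    finally show ?thesis using d by simp
  qed
  then show ?case by (simp add: algebra_simps)
qed

text \<open>A log-concave sequence lies below the geometric sequence through its values at \<open>0\<close> and \<open>1\<close>,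
  on both sides of \<open>0\<close>. Multiplying by \<open>r ^ j\<close> keeps the exponents nonnegative, which also covers
  the degenerate ratio \<open>r = 0\<close>.\<close>

lemma log_concave_mass_geometric_bound:
  assumes lc: "log_concave_mass f" and nn: "\<And>k. 0 \<le> f k" and pos: "0 < f 0"
  defines "r \<equiv> f 1 / f 0"
  shows "f (int k - int j) * r ^ j \<le> f 0 * r ^ k"
proof -
  have r0: "0 \<le> r" using nn[of 1] pos by (simp add: r_def)
  have right: "f (int i) \<le> f 0 * r ^ i" for i
  proof (induction i)
    case (Suc i)
    have "f 0 * f (int i + 1) \<le> f 1 * f (int i)"
    proof (cases i)
      case (Suc i')
      then show ?thesis using log_concave_mass_spread[OF lc nn, of 1 i'] by (simp add: algebra_simps)
    qed simp
    then have "f (int (Suc i)) \<le> r * f (int i)"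
      using pos by (simp add: r_def field_simps)
    also have "\<dots> \<le> r * (f 0 * r ^ i)" using Suc r0 by (rule mult_left_mono)
    finally show ?case by (simp add: mult_ac)
  qed simp
  have left: "f (- int i) * r ^ i \<le> f 0" for i
  proof (induction i)
    case (Suc i)
    have "f (- int i - 1) * f 1 \<le> f (- int i) * f 0"
      using log_concave_mass_spread[OF lc nn, of "- int i" i] by (simp add: algebra_simps)
    moreover have "- int (Suc i) = - int i - 1" by simp
    ultimately have "f (- int (Suc i)) * r \<le> f (- int i)"
      using pos by (simp only: r_def) (simp add: field_simps)
    then have "f (- int (Suc i)) * r * r ^ i \<le> f (- int i) * r ^ i"
      using r0 by (intro mult_right_mono) auto
    then show ?case using Suc by (simp add: mult_ac)
  qed simp
  show ?thesis
  proof (cases "j \<le> k")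
    case True
    have "f (int (k - j)) * r ^ j \<le> f 0 * r ^ (k - j) * r ^ j"
      using right[of "k - j"] r0 by (intro mult_right_mono) auto
    then show ?thesis using True by (simp add: of_nat_diff mult.assoc flip: power_add)
  next
    case False
    then have k: "k \<le> j" by simp
    have "f (- int (j - k)) * r ^ (j - k) * r ^ k \<le> f 0 * r ^ k"
      using left[of "j - k"] r0 by (intro mult_right_mono) auto
    then show ?thesis using k by (simp add: of_nat_diff mult.assoc flip: power_add)
  qed
qed

section \<open>Tails of a log-concave variable\<close>

definition tail :: "'a measure \<Rightarrow> ('a \<Rightarrow> int) \<Rightarrow> int \<Rightarrow> real" where
  "tail M X k = \<P>(\<omega> in M. X \<omega> \<ge> k)"

lemma mass_nonneg: "0 \<le> mass M X k"
  by (simp add: mass_def)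

lemma tail_nonneg: "0 \<le> tail M X k"
  by (simp add: tail_def)

lemma discrete_log_concaveD:
  assumes "discrete_log_concave M X"
  shows "prob_space M" "X \<in> measurable M (count_space UNIV)" "log_concave_mass (mass M X)"
  using assms by (auto simp: discrete_log_concave_def)

lemma tail_sums:
  assumes "prob_space M" and X[measurable]: "X \<in> measurable M (count_space UNIV)"
  shows "(\<lambda>j. mass M X (k + int j)) sums tail M X k"
proof -
  interpret prob_space M by fact
  define A where "A j = {\<omega> \<in> space M. X \<omega> = k + int j}" for j
  have "(\<lambda>j. measure M (A j)) sums measure M (\<Union>j. A j)"
    by (rule finite_measure_UNION) (auto simp: A_def disjoint_family_on_def)
  moreover have "(\<Union>j. A j) = {\<omega> \<in> space M. X \<omega> \<ge> k}"
    by (auto simp: A_def) (metis add.commute diff_add_cancel int_nat_eq diff_ge_0_iff_ge)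
  ultimately show ?thesis by (simp add: A_def mass_def tail_def)
qed

lemma tail_step:
  assumes "prob_space M" and X[measurable]: "X \<in> measurable M (count_space UNIV)"
  shows "tail M X k = mass M X k + tail M X (k + 1)"
proof -
  interpret prob_space M by fact
  have "{\<omega> \<in> space M. X \<omega> \<ge> k} = {\<omega> \<in> space M. X \<omega> = k} \<union> {\<omega> \<in> space M. X \<omega> \<ge> k + 1}"
    by auto
  then show ?thesis
    unfolding tail_def mass_def by (simp only:) (rule finite_measure_Union; auto)
qed

text \<open>Writing \<open>F\<close> for the tail and \<open>p\<close> for the mass function, the difference
  \<open>F(k)\<^sup>2 - F(k-1) F(k+1)\<close> equals \<open>p(k) F(k) - p(k-1) F(k+1)\<close>, which is the sum over \<open>j\<close> of the
  nonnegative terms \<open>p(k) p(k+j) - p(k-1) p(k+j+1)\<close>.\<close>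

lemma log_concave_tail:
  assumes "discrete_log_concave M X"
  shows "log_concave_mass (tail M X)"
proof -
  note D = discrete_log_concaveD[OF assms]
  interpret prob_space M by (fact D)
  note [measurable] = D(2)
  note step = tail_step[OF D(1,2)]
  have "tail M X (k - 1) * tail M X (k + 1) \<le> (tail M X k)\<^sup>2" for k
  proof -
    let ?p = "mass M X"
    have "(\<lambda>j. ?p (k - 1) * ?p (k + 1 + int j)) sums (?p (k - 1) * tail M X (k + 1))"
      by (intro sums_mult tail_sums D)
    moreover have "(\<lambda>j. ?p k * ?p (k + int j)) sums (?p k * tail M X k)"
      by (intro sums_mult tail_sums D)
    moreover have "?p (k - 1) * ?p (k + 1 + int j) \<le> ?p k * ?p (k + int j)" for j
      using log_concave_mass_spread[OF D(3) mass_nonneg, of k j] by (simp add: algebra_simps)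
    ultimately have "?p (k - 1) * tail M X (k + 1) \<le> ?p k * tail M X k"
      by (rule sums_le[rotated 1])
    moreover have "tail M X (k - 1) = ?p (k - 1) + tail M X k" using step[of "k - 1"] by simp
    moreover have "tail M X k = ?p k + tail M X (k + 1)" by (rule step)
    ultimately show ?thesis
      by (simp add: power2_eq_square algebra_simps)
  qed
  moreover have "tail M X j > 0" if "tail M X l > 0" "j \<le> l" for j l
  proof -
    have "tail M X l \<le> tail M X j"
      unfolding tail_def using that(2) by (intro finite_measure_mono) auto
    then show ?thesis using that(1) by simp
  qed
  ultimately show ?thesis unfolding log_concave_mass_def by blast
qed

text \<open>Reflections and translations are needed to read lower tails as upper ones.\<close>

lemma discrete_log_concave_reflect:
  assumes "discrete_log_concave M X"
  shows "discrete_log_concave M (\<lambda>\<omega>. c - X \<omega>)"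
proof -
  note D = discrete_log_concaveD[OF assms]
  note [measurable] = D(2)
  have eq: "mass M (\<lambda>\<omega>. c - X \<omega>) k = mass M X (c - k)" for k
    unfolding mass_def by (rule arg_cong[where f = "measure M"]) auto
  have "mass M X (c - (k - 1)) * mass M X (c - (k + 1)) \<le> (mass M X (c - k))\<^sup>2" for k
    using D(3)[unfolded log_concave_mass_def, THEN conjunct1, rule_format, of "c - k"]
    by (simp add: algebra_simps)
  moreover have "mass M X (c - j) > 0"
    if "i \<le> j" "j \<le> l" "mass M X (c - i) > 0" "mass M X (c - l) > 0" for i j l
    using D(3)[unfolded log_concave_mass_def, THEN conjunct2, rule_format, of "c - l" "c - j" "c - i"]
      that by simp
  ultimately have "log_concave_mass (mass M (\<lambda>\<omega>. c - X \<omega>))"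
    unfolding log_concave_mass_def eq by blast
  then show ?thesis using D by (simp add: discrete_log_concave_def)
qed

text \<open>The mean of a nonnegative integer variable is the sum of its tails, here dominated by a
  geometric series.\<close>

lemma geometric_tail_positive_part:
  assumes "prob_space M" and X[measurable]: "X \<in> measurable M (count_space UNIV)"
    and r: "0 \<le> r" "r < 1" and bound: "\<And>k. tail M X (m + int k) \<le> C * r ^ k"
  shows "integrable M (\<lambda>\<omega>. real (nat (X \<omega> - m + 1)))"
    and "(\<integral>\<omega>. real (nat (X \<omega> - m + 1)) \<partial>M) \<le> C / (1 - r)"
proof -
  interpret prob_space M by fact
  have C: "0 \<le> C" using bound[of 0] tail_nonneg[of M X m] by simp
  define f where "f \<omega> = nat (X \<omega> - m + 1)" for \<omega>
  have f[measurable]: "f \<in> measurable M (count_space UNIV)" unfolding f_def by measurable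
  have "(\<integral>\<^sup>+\<omega>. of_nat (f \<omega>) \<partial>M) = (\<Sum>k. emeasure M {\<omega>\<in>space M. k < f \<omega>})"
    by (rule nn_integral_nat_function[OF f])
  also have "\<dots> \<le> (\<Sum>k. ennreal (C * r ^ k))"
  proof (rule suminf_le)
    fix k
    have "{\<omega>\<in>space M. k < f \<omega>} = {\<omega>\<in>space M. X \<omega> \<ge> m + int k}" by (auto simp: f_def)
    then have "emeasure M {\<omega>\<in>space M. k < f \<omega>} = ennreal (tail M X (m + int k))"
      by (simp add: tail_def emeasure_eq_measure)
    then show "emeasure M {\<omega>\<in>space M. k < f \<omega>} \<le> ennreal (C * r ^ k)"
      using bound[of k] by (simp add: ennreal_leI)
  qed auto
  also have "\<dots> = ennreal (C * (1 / (1 - r)))"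
    using r C by (intro suminf_ennreal_eq sums_mult geometric_sums) auto
  finally have le: "(\<integral>\<^sup>+\<omega>. ennreal (real (f \<omega>)) \<partial>M) \<le> ennreal (C / (1 - r))"
    by (simp add: ennreal_of_nat_eq_real_of_nat)
  then show "integrable M (\<lambda>\<omega>. real (nat (X \<omega> - m + 1)))"
    unfolding f_def[symmetric]
    by (intro integrableI_nonneg) (auto intro: le_less_trans)
  show "(\<integral>\<omega>. real (nat (X \<omega> - m + 1)) \<partial>M) \<le> C / (1 - r)"
    unfolding f_def[symmetric] using le r C by (intro integral_real_bounded) auto
qed

text \<open>At any point \<open>m\<close> of the support the tail drops strictly, so from there on it decays at
  least geometrically.\<close>

lemma log_concave_positive_part_integrable:
  assumes lc: "discrete_log_concave M X"
  obtains m where "integrable M (\<lambda>\<omega>. real (nat (X \<omega> - m + 1)))"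
proof -
  note D = discrete_log_concaveD[OF lc]
  interpret prob_space M by (fact D)
  note [measurable] = D(2)
  have "\<exists>m. mass M X m > 0"
  proof (rule ccontr)
    assume "\<not> ?thesis"
    then have "AE \<omega> in M. X \<omega> \<noteq> m" for m
      using mass_nonneg[of M X m] by (subst AE_iff_measurable[OF _ refl])
        (auto simp: mass_def emeasure_eq_measure not_less intro: antisym)
    then have "AE \<omega> in M. \<forall>m. X \<omega> \<noteq> m" by (subst AE_all_countable) simp
    then show False by simp
  qed
  then obtain m where m: "mass M X m > 0" ..
  define f where "f k = tail M X (m + k)" for k
  define r where "r = f 1 / f 0"
  have fm: "f 0 = mass M X m + f 1" using tail_step[OF D(1,2), of m] by (simp add: f_def)
  have f0: "0 < f 0" and r: "0 \<le> r" "r < 1"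
    using fm m tail_nonneg[of M X "m + 1"] by (auto simp: r_def f_def)
  have lcf: "log_concave_mass f"
    using log_concave_tail[OF lc] unfolding log_concave_mass_def f_def
    by (smt (verit, best) add.assoc add_diff_eq)
  have "tail M X (m + int k) \<le> f 0 * r ^ k" for k
    using log_concave_mass_geometric_bound[OF lcf _ f0, of k 0]
    by (simp add: r_def f_def tail_nonneg)
  from geometric_tail_positive_part(1)[OF D(1,2) r this] show ?thesis by (rule that)
qed

lemma discrete_log_concave_integrable:
  assumes lc: "discrete_log_concave M X"
  shows "integrable M (\<lambda>\<omega>. real_of_int (X \<omega>))"
proof -
  note D = discrete_log_concaveD[OF lc]
  interpret prob_space M by (fact D)
  note [measurable] = D(2)
  obtain m where m: "integrable M (\<lambda>\<omega>. real (nat (X \<omega> - m + 1)))"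
    using log_concave_positive_part_integrable[OF lc] .
  obtain m' where m': "integrable M (\<lambda>\<omega>. real (nat (0 - X \<omega> - m' + 1)))"
    using log_concave_positive_part_integrable[OF discrete_log_concave_reflect[OF lc, of 0]] .
  let ?B = "\<lambda>\<omega>. real (nat (X \<omega> - m + 1)) + real (nat (0 - X \<omega> - m' + 1))
    + real_of_int (\<bar>m\<bar> + \<bar>m'\<bar> + 2)"
  show ?thesis
  proof (rule Bochner_Integration.integrable_bound)
    show "integrable M ?B" using m m' by simp
    have "\<bar>X \<omega>\<bar> \<le> int (nat (X \<omega> - m + 1)) + int (nat (0 - X \<omega> - m' + 1)) + (\<bar>m\<bar> + \<bar>m'\<bar> + 2)" for \<omega>
      by linarith
    then have "real_of_int \<bar>X \<omega>\<bar> \<le> real_of_int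
      (int (nat (X \<omega> - m + 1)) + int (nat (0 - X \<omega> - m' + 1)) + (\<bar>m\<bar> + \<bar>m'\<bar> + 2))" for \<omega>
      by (simp only: of_int_le_iff)
    then show "AE \<omega> in M. norm (real_of_int (X \<omega>)) \<le> norm (?B \<omega>)"
      by (intro AE_I2) (simp add: abs_of_nonneg)
  qed measurable
qed

section \<open>A log-concave variable with nonnegative mean\<close>

text \<open>For fixed \<open>r\<close> the quantity \<open>N * r^(N-1) * (1 - r)\<close> is largest at \<open>N = \<lfloor>v\<rfloor> + 1\<close>, where
  \<open>v = r / (1 - r)\<close> is the mean of the geometric law with ratio \<open>r\<close>. Its reciprocal is
  \<open>((v+1)/N) * (1 + 1/v)^(N-1)\<close>, and \<open>1 + x \<le> exp x\<close> bounds this by the exponential of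
  \<open>(v+1)/N - 1 + (N-1)/v\<close>. That exponent is at most \<open>1\<close> because it amounts to
  \<open>(v - N) * (v - (N-1)) \<le> 0\<close>.\<close>

lemma exists_geometric_weight_ge:
  fixes r :: real
  assumes r: "0 \<le> r" "r < 1"
  obtains n :: nat where "1 / exp 1 \<le> real (Suc n) * r ^ n * (1 - r)" "r ^ n > 0"
proof (cases "r = 0")
  case True
  show ?thesis by (rule that[of 0]) (auto simp: True)
next
  case False
  define v where "v = r / (1 - r)"
  have v: "0 < v" using r False by (simp add: v_def)
  define n where "n = nat \<lfloor>v\<rfloor>"
  have n: "real n \<le> v" "v \<le> real n + 1"
    using v unfolding n_def by linarith+
  define N where "N = real n + 1"
  have N: "0 < N" by (simp add: N_def)
  have rv: "1 / r = 1 + 1 / v" "1 / (1 - r) = v + 1"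
    using r False by (auto simp: v_def field_simps)
  have "(v + 1) / N * (1 + 1 / v) ^ n \<le> exp ((v + 1) / N - 1) * exp (1 / v) ^ n"
    using v N exp_ge_add_one_self[of "(v + 1) / N - 1"] exp_ge_add_one_self[of "1 / v"]
    by (intro mult_mono power_mono) auto
  also have "\<dots> = exp ((v + 1) / N - 1 + real n / v)"
    by (simp add: exp_add exp_of_nat_mult[symmetric])
  also have "\<dots> \<le> exp 1"
  proof -
    have "(v - N) * (v - real n) \<le> 0"
      using n by (intro mult_nonpos_nonneg) (auto simp: N_def)
    then have "(v + 1) * v + real n * N \<le> 2 * N * v"
      by (simp add: N_def algebra_simps)
    then have "(v + 1) / N + real n / v \<le> 2" using v N by (simp add: field_simps)
    then show ?thesis by simp
  qed
  finally have "(v + 1) / N * (1 + 1 / v) ^ n \<le> exp 1" .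
  moreover have "(v + 1) / N * (1 + 1 / v) ^ n = 1 / (N * r ^ n * (1 - r))"
    unfolding rv[symmetric] by (simp add: field_simps)
  moreover have pos: "0 < N * r ^ n * (1 - r)" using N r False by simp
  ultimately have "1 / exp 1 \<le> N * r ^ n * (1 - r)"
    by (simp add: field_simps)
  then show ?thesis using that[of n] r False by (simp add: N_def add.commute)
qed

lemma log_concave_prob_nonneg_ge:
  assumes lc: "discrete_log_concave M W" and mean: "0 \<le> (\<integral>\<omega>. real_of_int (W \<omega>) \<partial>M)"
  shows "1 / exp 1 \<le> tail M W 0"
proof -
  note D = discrete_log_concaveD[OF lc]
  interpret prob_space M by (fact D)
  note [measurable] = D(2)
  note int = discrete_log_concave_integrable[OF lc]
  note lcF = log_concave_tail[OF lc]
  have s0: "0 < tail M W 0"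
  proof (rule ccontr)
    assume "\<not> ?thesis"
    then have "tail M W 0 = 0" using tail_nonneg[of M W 0] by simp
    then have "AE \<omega> in M. \<not> 0 \<le> W \<omega>"
      by (subst AE_iff_measurable[OF _ refl]) (auto simp: tail_def emeasure_eq_measure)
    then have "AE \<omega> in M. real_of_int (W \<omega>) \<le> -1" by eventually_elim linarith
    then have "(\<integral>\<omega>. real_of_int (W \<omega>) \<partial>M) \<le> (\<integral>\<omega>. -1 \<partial>M)"
      using int by (intro integral_mono_AE) auto
    then show False using mean by (simp add: prob_space)
  qed
  define r where "r = tail M W 1 / tail M W 0"
  have r0: "0 \<le> r" by (simp add: r_def tail_nonneg)
  show ?thesis
  proof (cases "mass M W 0 = 0")
    case True
    \<comment> \<open>Now \<open>r = 1\<close>, so the tail is at most \<open>P(W \<ge> 0)\<close> everywhere. As it tends to \<open>1\<close> at minus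
      infinity, this forces \<open>P(W \<ge> 0) = 1\<close>.\<close>
    have "tail M W 0 = tail M W 1" using tail_step[OF D(1,2), of 0] True by simp
    then have r1: "r = 1" using s0 by (simp add: r_def)
    have le: "tail M W (- int j) \<le> tail M W 0" for j
      using log_concave_mass_geometric_bound[OF lcF tail_nonneg s0, of 0 j] r1
      by (simp add: r_def)
    have "(\<lambda>j. measure M {\<omega> \<in> space M. W \<omega> \<ge> - int j})
        \<longlonglongrightarrow> measure M (\<Union>j. {\<omega> \<in> space M. W \<omega> \<ge> - int j})"
      by (rule finite_Lim_measure_incseq) (auto simp: incseq_def)
    moreover have "(\<Union>j. {\<omega> \<in> space M. W \<omega> \<ge> - int j}) = space M"
    proof safe
      fix \<omega> assume "\<omega> \<in> space M"
      then show "\<omega> \<in> (\<Union>j. {\<omega> \<in> space M. W \<omega> \<ge> - int j})"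
        by (intro UN_I[of "nat (- W \<omega>)"]) auto
    qed
    ultimately have "1 \<le> tail M W 0"
      using le by (intro LIMSEQ_le_const2[where X = "\<lambda>j. tail M W (- int j)"])
        (auto simp: tail_def prob_space)
    moreover have "1 / exp 1 \<le> (1 :: real)" by simp
    ultimately show ?thesis by linarith
  next
    case False
    then have "mass M W 0 > 0" using mass_nonneg[of M W 0] by simp
    then have r: "r < 1" using tail_step[OF D(1,2), of 0] s0 by (simp add: r_def)
    obtain n where n: "1 / exp 1 \<le> real (Suc n) * r ^ n * (1 - r)" "r ^ n > 0"
      using exists_geometric_weight_ge[OF r0 r] .
    define C where "C = tail M W 0 / r ^ n"
    have "tail M W (- int n + int k) \<le> C * r ^ k" for k
      using log_concave_mass_geometric_bound[OF lcF tail_nonneg s0, of k n] n(2)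
      by (simp add: r_def[symmetric] C_def field_simps)
    note V = geometric_tail_positive_part[OF D(1,2) r0 r this]
    have "real (Suc n) \<le> (\<integral>\<omega>. real_of_int (W \<omega>) + real (Suc n) \<partial>M)"
      using mean int by (simp add: prob_space)
    also have "\<dots> \<le> (\<integral>\<omega>. real (nat (W \<omega> - - int n + 1)) \<partial>M)"
      using int V(1) by (intro integral_mono) auto
    also have "\<dots> \<le> C / (1 - r)" by (rule V(2))
    finally have "real (Suc n) * r ^ n * (1 - r) \<le> tail M W 0"
      using r n(2) by (simp add: C_def field_simps)
    then show ?thesis using n(1) by linarith
  qed
qed

lemma upper_deviation_prob_le:
  assumes lc: "discrete_log_concave M X" and t: "1 \<le> t"
  shows "upper_deviation_prob t M X \<le> 1 - 1 / exp 1"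
proof -
  note D = discrete_log_concaveD[OF lc]
  interpret prob_space M by (fact D)
  note [measurable] = D(2)
  define \<mu> where "\<mu> = (\<integral>\<omega>. real_of_int (X \<omega>) \<partial>M)"
  define m where "m = \<lceil>\<mu> + t\<rceil>"
  define W where "W \<omega> = (m - 1) - X \<omega>" for \<omega>
  have lcW: "discrete_log_concave M W"
    unfolding W_def by (rule discrete_log_concave_reflect[OF lc])
  have "(\<integral>\<omega>. real_of_int (W \<omega>) \<partial>M) = real_of_int m - 1 - \<mu>"
    using discrete_log_concave_integrable[OF lc] by (simp add: W_def \<mu>_def prob_space)
  also have "\<dots> \<ge> 0" using t unfolding m_def by linarith
  finally have "1 / exp 1 \<le> tail M W 0" by (rule log_concave_prob_nonneg_ge[OF lcW])
  moreover have "upper_deviation_prob t M X = \<P>(\<omega> in M. \<not> 0 \<le> W \<omega>)"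
    unfolding upper_deviation_prob_def \<mu>_def[symmetric]
    by (rule arg_cong[where f = "measure M"]) (auto simp: W_def m_def less_ceiling_iff)
  moreover have "\<P>(\<omega> in M. \<not> 0 \<le> W \<omega>) = 1 - tail M W 0"
    unfolding tail_def W_def by (rule prob_neg) simp
  ultimately show ?thesis by simp
qed

section \<open>Sharpness\<close>

definition neg_geometric_pmf :: "real \<Rightarrow> int pmf" where
  "neg_geometric_pmf q = map_pmf (\<lambda>n. - int n) (geometric_pmf (1 - q))"

lemma mass_neg_geometric:
  assumes q: "0 < q" "q < 1"
  shows "mass (neg_geometric_pmf q) id k = (if k \<le> 0 then q ^ nat (- k) * (1 - q) else 0)"
proof -
  have "mass (neg_geometric_pmf q) id k = pmf (neg_geometric_pmf q) k"
    by (simp add: mass_def pmf.rep_eq)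
  also have "\<dots> = (if k \<le> 0 then q ^ nat (- k) * (1 - q) else 0)"
  proof (cases "k \<le> 0")
    case True
    then have "pmf (neg_geometric_pmf q) (- int (nat (- k))) = pmf (geometric_pmf (1 - q)) (nat (- k))"
      unfolding neg_geometric_pmf_def by (intro pmf_map_inj') (auto simp: inj_def)
    then show ?thesis using True q by simp
  next
    case False
    then show ?thesis
      unfolding neg_geometric_pmf_def by (auto simp: pmf_eq_0_set_pmf)
  qed
  finally show ?thesis .
qed

lemma discrete_log_concave_neg_geometric:
  assumes q: "0 < q" "q < 1"
  shows "discrete_log_concave (neg_geometric_pmf q) id"
proof -
  have "mass (neg_geometric_pmf q) id (k - 1) * mass (neg_geometric_pmf q) id (k + 1)
      \<le> (mass (neg_geometric_pmf q) id k)\<^sup>2" for k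
  proof (cases "k + 1 \<le> 0")
    case True
    then have e: "nat (- (k - 1)) + nat (- (k + 1)) = nat (- k) + nat (- k)" by linarith
    have "q ^ nat (- (k - 1)) * q ^ nat (- (k + 1)) = q ^ nat (- k) * q ^ nat (- k)"
      by (simp only: e flip: power_add)
    then show ?thesis using True by (simp add: mass_neg_geometric[OF q] power2_eq_square algebra_simps)
  qed (simp add: mass_neg_geometric[OF q])
  moreover have "mass (neg_geometric_pmf q) id j > 0"
    if "j \<le> l" "mass (neg_geometric_pmf q) id l > 0" for j l
    using that q by (auto simp: mass_neg_geometric[OF q] split: if_splits)
  ultimately show ?thesis
    unfolding discrete_log_concave_def log_concave_mass_def
    by (auto intro: measure_pmf.prob_space_axioms)
qed

text \<open>The ratio is chosen so that the geometric variable has mean \<open>q / (1 - q) = n + t\<close>; the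
  deviation event is then exactly that it is at most \<open>n\<close>.\<close>

lemma upper_deviation_prob_neg_geometric:
  fixes t :: real and n :: nat
  assumes t: "0 < t"
  defines "q \<equiv> (real n + t) / (real n + t + 1)"
  shows "upper_deviation_prob t (neg_geometric_pmf q) id = 1 - q ^ Suc n"
proof -
  have q: "0 < q" "q < 1" using t by (auto simp: q_def field_simps)
  have ratio: "q / (1 - q) = real n + t" using t by (simp add: q_def field_simps)
  have "(\<integral>k. real_of_int (id k) \<partial>neg_geometric_pmf q)
      = - measure_pmf.expectation (geometric_pmf (1 - q)) real"
    by (simp add: neg_geometric_pmf_def)
  also have "\<dots> = - (real n + t)"
    using q ratio by (subst expectation_geometric_pmf) auto
  finally have mean: "(\<integral>k. real_of_int (id k) \<partial>neg_geometric_pmf q) = - (real n + t)" .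
  have "upper_deviation_prob t (neg_geometric_pmf q) id
      = measure (neg_geometric_pmf q) {k. real_of_int k \<ge> - real n}"
    unfolding upper_deviation_prob_def mean by simp
  also have "\<dots> = measure (geometric_pmf (1 - q)) {..n}"
    unfolding neg_geometric_pmf_def measure_map_pmf
    by (rule arg_cong[where f = "measure _"]) auto
  also have "\<dots> = (\<Sum>i\<le>n. q ^ i * (1 - q))"
    using q by (subst measure_measure_pmf_finite) auto
  also have "\<dots> = 1 - q ^ Suc n"
    using sum_gp_basic[of q n] by (simp add: mult.commute flip: sum_distrib_left)
  finally show ?thesis .
qed

lemma exists_upper_deviation_prob_gt:
  assumes t: "0 < t" and c: "c < 1 - 1 / exp (1 :: real)"
  obtains q where "discrete_log_concave (neg_geometric_pmf q) id"
    and "c < upper_deviation_prob t (neg_geometric_pmf q) id"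
proof -
  have "(\<lambda>n. 1 - ((real n + t) / (real n + t + 1)) ^ Suc n) \<longlonglongrightarrow> 1 - 1 / exp 1"
    by (real_asymp simp: exp_minus field_simps)
  then have "\<forall>\<^sub>F n in sequentially. c < 1 - ((real n + t) / (real n + t + 1)) ^ Suc n"
    using c by (rule order_tendstoD)
  then obtain n where n: "c < 1 - ((real n + t) / (real n + t + 1)) ^ Suc n"
    unfolding eventually_sequentially by blast
  show ?thesis
  proof (rule that)
    show "discrete_log_concave (neg_geometric_pmf ((real n + t) / (real n + t + 1))) id"
      using t by (intro discrete_log_concave_neg_geometric) (auto simp: field_simps)
  qed (use n upper_deviation_prob_neg_geometric[OF t, of n] in simp)
qed

theorem mainTheorem3:
  fixes t :: real
  assumes "t \<ge> 1"
  shows "(\<forall>(M :: 'a measure) X. discrete_log_concave M X \<longrightarrow>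
            upper_deviation_prob t M X \<le> 1 - 1 / exp 1) \<and>
         (\<forall>c < 1 - 1 / exp 1. \<exists>(M, X) \<in> log_concave_variables. upper_deviation_prob t M X > c) \<and>
         (SUP (M, X) \<in> log_concave_variables. upper_deviation_prob t M X) = 1 - 1 / exp 1"
proof (intro conjI allI impI)
  fix M :: "'a measure" and X
  assume "discrete_log_concave M X"
  then show "upper_deviation_prob t M X \<le> 1 - 1 / exp 1"
    using assms by (rule upper_deviation_prob_le)
next
  have sharp: "\<exists>(M, X) \<in> log_concave_variables. upper_deviation_prob t M X > c"
    if c: "c < 1 - 1 / exp 1" for c
  proof -
    obtain q where "discrete_log_concave (neg_geometric_pmf q) id"
      and "c < upper_deviation_prob t (neg_geometric_pmf q) id"
      using exists_upper_deviation_prob_gt[OF _ c] assms by (metis less_le_trans zero_less_one)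
    then show ?thesis
      by (intro bexI[of _ "(measure_pmf (neg_geometric_pmf q), id)"])
        (auto simp: log_concave_variables_def)
  qed
  then show "\<exists>(M, X) \<in> log_concave_variables. upper_deviation_prob t M X > c"
    if "c < 1 - 1 / exp 1" for c using that .
  have ub: "(case Z of (M, X) \<Rightarrow> upper_deviation_prob t M X) \<le> 1 - 1 / exp 1"
    if "Z \<in> log_concave_variables" for Z
    using that assms by (auto simp: log_concave_variables_def intro: upper_deviation_prob_le)
  show "(SUP (M, X) \<in> log_concave_variables. upper_deviation_prob t M X) = 1 - 1 / exp 1"
  proof (rule cSup_eq)
    show "x \<le> 1 - 1 / exp 1"
      if "x \<in> (\<lambda>(M, X). upper_deviation_prob t M X) ` log_concave_variables" for x
      using that ub by auto
    fix y
    assume y: "\<And>x. x \<in> (\<lambda>(M, X). upper_deviation_prob t M X) ` log_concave_variables \<Longrightarrow> x \<le> y"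
    show "1 - 1 / exp 1 \<le> y"
    proof (rule ccontr)
      assume "\<not> ?thesis"
      then obtain Z where "Z \<in> log_concave_variables" "(case Z of (M, X) \<Rightarrow> upper_deviation_prob t M X) > y"
        using sharp[of y] by auto
      then show False using y by (meson imageI not_le)
    qed
  qed
qed

end
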